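(* There are real numbers $C_k$ ($k=2,3,4,\dots$), with $C_2=37$ and $\limsup_{k\to\infty} C_k/(3ek^3)\le 1$, such that for every integer $k\ge 2$ and every integer $c\ge C_k$, Player 1 has a strategy in the $c$-ary sequence game which ensures that for every $r\ge 2$, every block (interval of consecutive positions) of length $\ge kr$ contains either a $k$-term rainbow arithmetic progression of difference $r$ (if $r$ is even) or a prismatic pair of $k$-term arithmetic progressions of difference $r$ (if $r$ is odd). In particular, among any $k$ consecutive blocks of any equal length $r\ge 2$ in the sequence resulting from game-play, no two are identical.
   Context: The $c$-ary sequence game: two players alternately choose symbols from a fixed set of $c$ symbols, forming an unending sequence $\chi(1)\chi(2)\chi(3)\dots$. Player 1 chooses $\chi(1),\chi(3),\chi(5),\dots$ and Player 2 chooses $\chi(2),\chi(4),\chi(6),\dots$; each choice is made with full knowledge of all previous choices. A strategy for Player 1 is a function assigning to each finite history ending just before a move of Player 1 the symbol he plays. It ensures a property if every infinite sequence resulting from play in which Player 1 follows the strategy (with arbitrary moves by Player 2) has that property. The resulting sequence is regarded as a coloring $\chi$ of the positive integers. A rainbow arithmetic progression is an arithmetic progression (of positive integers) all of whose terms get different colors under $\chi$. A prismatic pair of $k$-term arithmetic progressions of difference $r$ is a pair of arithmetic progressions $\alpha_1<\alpha_2<\dots<\alpha_k$ and $\beta_1<\beta_2<\dots<\beta_k$ of positive integers, each of difference $r$, such that $\beta_i=\alpha_i+1$ for all $1\le i\le k$, and $\chi(\alpha_i)\ne\chi(\alpha_j)$ for all $\alpha_i<\alpha_j$ with $\alpha_j$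 odd, and $\chi(\beta_i)\ne\chi(\beta_j)$ for all $\beta_i<\beta_j$ with $\beta_j$ odd. A block contains a prismatic pair if it contains all terms of both progressions. Consecutive blocks are blocks each of which begins immediately after the previous one ends. *)

theory Defs
  imports Complex_Main "HOL-Library.Extended_Real"
begin

text \<open>
  The symbols of the c-ary game are the naturals below c. A sequence
  is a function on \<^typ>\<open>nat\<close> of which only the values at positive positions matter: no
  definition below inspects the value at 0.
\<close>

text \<open>
  A strategy maps the history, listed in order of play, to the next symbol. Player 1 moves
  exactly after histories of even length; the values on other lists are junk.
\<close>

definition player1_strategy :: "nat \<Rightarrow> (nat list \<Rightarrow> nat) \<Rightarrow> bool" where
  "player1_strategy c \<sigma> \<longleftrightarrow>
     (\<forall>h. set h \<subseteq> {..<c} \<and> even (length h) \<longrightarrow> \<sigma> h \<in> {..<c})"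

definition play_following :: "nat \<Rightarrow> (nat list \<Rightarrow> nat) \<Rightarrow> (nat \<Rightarrow> nat) \<Rightarrow> bool" where
  "play_following c \<sigma> \<chi> \<longleftrightarrow>
     (\<forall>n\<ge>1. \<chi> n \<in> {..<c}) \<and> (\<forall>n. odd n \<longrightarrow> \<chi> n = \<sigma> (map \<chi> [1..<n]))"

definition ensures :: "nat \<Rightarrow> (nat list \<Rightarrow> nat) \<Rightarrow> ((nat \<Rightarrow> nat) \<Rightarrow> bool) \<Rightarrow> bool" where
  "ensures c \<sigma> P \<longleftrightarrow> (\<forall>\<chi>. play_following c \<sigma> \<chi> \<longrightarrow> P \<chi>)"

text \<open>The terms of a progression are indexed by 1, ..., k; other values of \<open>\<alpha>\<close> are junk.\<close>

definition arith_prog :: "nat \<Rightarrow> nat \<Rightarrow> (nat \<Rightarrow> nat) \<Rightarrow> bool" where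
  "arith_prog k r \<alpha> \<longleftrightarrow>
     (\<forall>i\<in>{1..k}. \<alpha> i \<ge> 1) \<and> (\<forall>i\<in>{1..<k}. \<alpha> (i + 1) = \<alpha> i + r)"

definition rainbow_ap :: "(nat \<Rightarrow> nat) \<Rightarrow> nat \<Rightarrow> nat \<Rightarrow> (nat \<Rightarrow> nat) \<Rightarrow> bool" where
  "rainbow_ap \<chi> k r \<alpha> \<longleftrightarrow> arith_prog k r \<alpha> \<and> inj_on \<chi> (\<alpha> ` {1..k})"

definition prismatic_pair ::
  "(nat \<Rightarrow> nat) \<Rightarrow> nat \<Rightarrow> nat \<Rightarrow> (nat \<Rightarrow> nat) \<Rightarrow> (nat \<Rightarrow> nat) \<Rightarrow> bool" where
  "prismatic_pair \<chi> k r \<alpha> \<beta> \<longleftrightarrow>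
     arith_prog k r \<alpha> \<and> arith_prog k r \<beta> \<and>
     (\<forall>i\<in>{1..k}. \<beta> i = \<alpha> i + 1) \<and>
     (\<forall>i\<in>{1..k}. \<forall>j\<in>{1..k}. \<alpha> i < \<alpha> j \<and> odd (\<alpha> j) \<longrightarrow> \<chi> (\<alpha> i) \<noteq> \<chi> (\<alpha> j)) \<and>
     (\<forall>i\<in>{1..k}. \<forall>j\<in>{1..k}. \<beta> i < \<beta> j \<and> odd (\<beta> j) \<longrightarrow> \<chi> (\<beta> i) \<noteq> \<chi> (\<beta> j))"

definition block :: "nat \<Rightarrow> nat \<Rightarrow> nat set" where
  "block a l = {a..<a + l}"

definition block_word :: "(nat \<Rightarrow> nat) \<Rightarrow> nat \<Rightarrow> nat \<Rightarrow> nat list" where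
  "block_word \<chi> a l = map \<chi> [a..<a + l]"

definition contains_rainbow_ap :: "(nat \<Rightarrow> nat) \<Rightarrow> nat \<Rightarrow> nat \<Rightarrow> nat set \<Rightarrow> bool" where
  "contains_rainbow_ap \<chi> k r B \<longleftrightarrow> (\<exists>\<alpha>. rainbow_ap \<chi> k r \<alpha> \<and> \<alpha> ` {1..k} \<subseteq> B)"

definition contains_prismatic_pair :: "(nat \<Rightarrow> nat) \<Rightarrow> nat \<Rightarrow> nat \<Rightarrow> nat set \<Rightarrow> bool" where
  "contains_prismatic_pair \<chi> k r B \<longleftrightarrow>
     (\<exists>\<alpha> \<beta>. prismatic_pair \<chi> k r \<alpha> \<beta> \<and> \<alpha> ` {1..k} \<subseteq> B \<and> \<beta> ` {1..k} \<subseteq> B)"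

end

theory Submission
  imports Defs "HOL-Library.FuncSet"
begin

text \<open>
  If a block of length \<open>kr\<close> contains no progression (or prismatic pair) of the required kind, then
  in each of \<open>r div 2\<close> disjoint pairs of adjacent residue classes a symbol of Player 1 repeats an
  earlier symbol of the same class. Fix a strategy of Player 2. Given the places where this happens,
  \<open>r div 2\<close> of the at most about \<open>(k - 1) r / 2\<close> last symbols of Player 1 in the block are determined
  by the preceding play. Counting in the style of Rosenfeld, in place of the local lemma, then shows
  by induction that the number of words of Player 1 avoiding such blocks grows by a factor of at
  least \<open>c (1 - 1 / (2k))\<close> with each letter, as soon as \<open>c \<ge> 8 k\<^sup>2 (k - 1)\<close>. So no strategy of
  Player 2 forces a bad block within finitely many rounds, and since the game is closed for Player 1
  with finitely many symbols, Player 1 can avoid bad blocks forever. The bound on \<open>c\<close> is 32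
  for \<open>k = 2\<close>, and \<open>8 \<le> 3e\<close>.
\<close>

section \<open>Safety games\<close>

text \<open>The history when Player 1 spells \<open>w\<close> and Player 2 answers by
  \<open>\<tau>\<close>. Against a fixed \<open>\<tau>\<close>, words thus parametrise plays; the
  letter \<open>w ! v\<close> sits at list index \<open>2 * v\<close>, that is, at position 2v +
  1.\<close>

definition play :: "(nat list \<Rightarrow> nat) \<Rightarrow> nat list \<Rightarrow> nat list" where
  "play \<tau> w = foldl (\<lambda>h x. h @ [x, \<tau> (h @ [x])]) [] w"

lemma play_Nil [simp]: "play \<tau> [] = []"
  by (simp add: play_def)

lemma play_snoc [simp]: "play \<tau> (w @ [x]) = play \<tau> w @ [x, \<tau> (play \<tau> w @ [x])]"
  by (simp add: play_def)

lemma length_play [simp]: "length (play \<tau> w) = 2 * length w"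
  by (induction w rule: rev_induct) auto

lemma take_play: "m \<le> length w \<Longrightarrow> take (2 * m) (play \<tau> w) = play \<tau> (take m w)"
proof (induction w rule: rev_induct)
  case (snoc x w)
  show ?case
  proof (cases "m = Suc (length w)")
    case False
    then show ?thesis using snoc by simp
  qed simp
qed simp

lemma play_nth_even: "v < length w \<Longrightarrow> play \<tau> w ! (2 * v) = w ! v"
  by (induction w rule: rev_induct) (auto simp: nth_append less_Suc_eq)

text \<open>Backward induction for the game with \<open>n\<close> rounds left; the quantifier order
  lets Player 2 see \<open>x\<close> before choosing \<open>y\<close>.\<close>

primrec survives :: "nat \<Rightarrow> (nat list \<Rightarrow> bool) \<Rightarrow> nat \<Rightarrow> nat list \<Rightarrow> bool" where
  "survives c G 0 h = G h"
| "survives c G (Suc n) h = (G h \<and> (\<exists>x<c. \<forall>y<c. survives c G n (h @ [x, y])))"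

lemma survives_Suc: "survives c G (Suc n) h \<Longrightarrow> survives c G n h"
proof (induction n arbitrary: h)
  case (Suc n)
  then show ?case by (metis survives.simps(2))
qed simp

lemma survives_antimono: "n \<le> m \<Longrightarrow> survives c G m h \<Longrightarrow> survives c G n h"
  by (induction rule: dec_induct) (auto dest: survives_Suc simp del: survives.simps)

text \<open>Compactness: if every \<open>x\<close> failed, each would have a spoiling reply and a
  horizon; survival for one round more than the largest of these finitely many horizons is then
  impossible.\<close>

lemma survives_forever_step:
  assumes "\<And>n. survives c G n h"
  shows "\<exists>x<c. \<forall>y<c. \<forall>n. survives c G n (h @ [x, y])"
proof (rule ccontr)
  assume "\<not> ?thesis"
  then have "\<forall>x. \<exists>y n. x < c \<longrightarrow> y < c \<and> \<not> survives c G n (h @ [x, y])" by blast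
  then obtain Y N where YN: "\<And>x. x < c \<Longrightarrow> Y x < c \<and> \<not> survives c G (N x) (h @ [x, Y x])"
    by metis
  obtain x where "x < c" "\<forall>y<c. survives c G (Max (N ` {..<c})) (h @ [x, y])"
    using assms[of "Suc (Max (N ` {..<c}))"] by auto
  moreover from this have "N x \<le> Max (N ` {..<c})" by simp
  ultimately show False using YN survives_antimono by blast
qed

text \<open>Finite-horizon determinacy: Player 2 always picks a reply after which Player 1 still
  cannot survive the remaining rounds.\<close>

lemma not_survives_reply:
  assumes "\<not> survives c G N []"
  obtains \<tau> where "\<And>w. length w = N \<Longrightarrow> set w \<subseteq> {..<c} \<Longrightarrow> \<exists>m\<le>N. \<not> G (play \<tau> (take m w))"
proof -
  \<comment> \<open>The rounds left are read off the history: in round m, counted from 0, Player 2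
    sees length 2m + 1, and \<open>N - Suc m\<close> rounds remain afterwards.\<close>
  define \<tau> where "\<tau> h = (SOME y. \<not> survives c G (N - Suc (length h div 2)) (h @ [y]))" for h
  have "\<exists>m\<le>N. \<not> G (play \<tau> (take m w))" if w: "length w = N" "set w \<subseteq> {..<c}" for w
  proof (rule ccontr)
    assume "\<not> ?thesis"
    then have G: "G (play \<tau> (take m w))" if "m \<le> N" for m using that by blast
    have "\<not> survives c G (N - m) (play \<tau> (take m w))" if "m \<le> N" for m
      using that
    proof (induction m)
      case 0
      then show ?case using assms by simp
    next
      case (Suc m)
      let ?h = "play \<tau> (take m w)"
      have lt: "m < N" using Suc.prems by simp
      then have "w ! m \<in> set w" using w(1) by simp
      then have wm: "w ! m < c" using w(2) by auto
      have "\<not> survives c G (Suc (N - Suc m)) ?h"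
        using Suc lt by (simp add: Suc_diff_Suc del: survives.simps)
      then have "\<exists>y. \<not> survives c G (N - Suc m) (?h @ [w ! m] @ [y])"
        using G[of m] lt wm by auto
      then have "\<exists>y. \<not> survives c G (N - Suc (length (?h @ [w ! m]) div 2)) ((?h @ [w ! m]) @ [y])"
        using lt w by (simp add: min_def)
      from someI_ex[OF this]
      have "\<not> survives c G (N - Suc m) ((?h @ [w ! m]) @ [\<tau> (?h @ [w ! m])])"
        unfolding \<tau>_def[symmetric] using lt w by (simp add: min_def)
      then show ?case using lt w by (simp add: take_Suc_conv_app_nth)
    qed
    from this[of N] G[of N] show False by simp
  qed
  then show ?thesis using that by blast
qed

text \<open>Finitely many colours make "surviving every finite number of rounds" inherit to a
  suitable successor, so finite-horizon determinacy suffices for the infinite game.\<close>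

lemma safety_strategy:
  assumes "c > 0"
    and survivor: "\<And>n \<tau>. \<exists>w. length w = n \<and> set w \<subseteq> {..<c} \<and> (\<forall>m\<le>n. G (play \<tau> (take m w)))"
  shows "\<exists>\<sigma>. player1_strategy c \<sigma> \<and> ensures c \<sigma> (\<lambda>\<chi>. \<forall>n. G (map \<chi> [1..<2 * n + 1]))"
proof -
  define safe where "safe h \<longleftrightarrow> (\<forall>n. survives c G n h)" for h
  \<comment> \<open>The value 0 on unsafe histories only keeps \<open>\<sigma>\<close> legal; the
    play stays among safe ones.\<close>
  define \<sigma> where "\<sigma> h = (if safe h then SOME x. x < c \<and> (\<forall>y<c. safe (h @ [x, y])) else 0)" for h
  have \<sigma>: "\<sigma> h < c \<and> (\<forall>y<c. safe (h @ [\<sigma> h, y]))" if "safe h" for h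
  proof -
    have "\<exists>x. x < c \<and> (\<forall>y<c. safe (h @ [x, y]))"
      using survives_forever_step[of c G h] that unfolding safe_def by blast
    from someI_ex[OF this] show ?thesis using that by (simp add: \<sigma>_def)
  qed
  \<comment> \<open>Otherwise \<open>not_survives_reply\<close> gives Player 2 a strategy that
    \<open>survivor\<close> refutes.\<close>
  have "safe []"
    unfolding safe_def by (metis survivor not_survives_reply)
  have "safe (map \<chi> [1..<2 * n + 1])" if "play_following c \<sigma> \<chi>" for \<chi> n
  proof (induction n)
    case 0
    then show ?case using \<open>safe []\<close> by simp
  next
    case (Suc n)
    have p1: "\<chi> (2 * n + 1) = \<sigma> (map \<chi> [1..<2 * n + 1])" and p2: "\<chi> (2 * n + 2) < c"
      using that by (auto simp: play_following_def)
    have "[1..<2 * Suc n + 1] = [1..<2 * n + 1] @ [2 * n + 1, 2 * n + 2]"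
      by simp
    then have "map \<chi> [1..<2 * Suc n + 1] = map \<chi> [1..<2 * n + 1] @ [\<chi> (2 * n + 1), \<chi> (2 * n + 2)]"
      by (simp only: map_append list.map)
    then show ?case using \<sigma>[OF Suc] p1 p2 by (simp only:)
  qed
  then have "ensures c \<sigma> (\<lambda>\<chi>. \<forall>n. G (map \<chi> [1..<2 * n + 1]))"
    unfolding ensures_def safe_def using survives.simps(1)[of c G] by blast
  moreover have "\<sigma> h < c" for h
    using \<sigma>[of h] \<open>c > 0\<close> by (cases "safe h") (simp_all add: \<sigma>_def)
  then have "player1_strategy c \<sigma>" by (simp add: player1_strategy_def)
  ultimately show ?thesis by blast
qed

section \<open>Repetition patterns\<close>

text \<open>Of the two positions \<open>N = 2b + 1 + 2s + jr\<close> and \<open>N + 1\<close>, exactly one belongs to Player 1;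
  it is \<open>2v + 1\<close> with \<open>v = p1_index b r s j\<close>.\<close>

definition p1_index :: "nat \<Rightarrow> nat \<Rightarrow> nat \<Rightarrow> nat \<Rightarrow> nat" where
  "p1_index b r s j = b + s + (1 + j * r) div 2"

text \<open>The bad event: in each of the \<open>r div 2\<close> pairs of residue classes, some
  Player 1 position has a colour that occurred earlier in its class. For odd \<open>r\<close> the
  earlier position may be Player 2's.\<close>

definition repeats :: "(nat \<Rightarrow> nat) \<Rightarrow> nat \<Rightarrow> nat \<Rightarrow> nat \<Rightarrow> bool" where
  "repeats \<chi> k b r \<longleftrightarrow>
     (\<forall>s<r div 2. \<exists>i j. i < j \<and> j < k \<and>
        \<chi> (2 * p1_index b r s j + 1 - (j - i) * r) = \<chi> (2 * p1_index b r s j + 1))"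

definition good :: "nat \<Rightarrow> nat list \<Rightarrow> bool" where
  "good k h \<longleftrightarrow>
     (\<forall>b r. r \<ge> 2 \<and> 2 * (b + k * r div 2) \<le> length h \<longrightarrow> \<not> repeats (\<lambda>p. h ! (p - 1)) k b r)"

text \<open>The later term of a repetition has \<open>1 \<le> j\<close>, so forced letters occur
  only after a prefix of this length; the counting keeps exactly that prefix.\<close>

lemma p1_index_ge: "1 \<le> j \<Longrightarrow> b + (r + 1) div 2 \<le> p1_index b r s j"
  unfolding p1_index_def by (cases j) (auto intro: div_le_mono)

lemma p1_index_less:
  assumes "j < k" "s < r div 2"
  shows "p1_index b r s j < b + k * r div 2"
proof -
  have "Suc j * r \<le> k * r" using assms by (intro mult_le_mono1) simp
  then have "r + j * r \<le> k * r" by simp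
  \<comment> \<open>For even \<open>r\<close>, rounding up in \<open>(1 + z) div 2\<close> would
    cost one if \<open>z\<close> were odd; but \<open>z = j * r\<close> is then even.\<close>
  moreover have "r div 2 + (1 + z) div 2 \<le> u div 2" if "r + z \<le> u" "even r \<Longrightarrow> even z" for z u :: nat
    using that by presburger
  ultimately have "r div 2 + (1 + j * r) div 2 \<le> k * r div 2" by simp
  then show ?thesis using assms by (simp add: p1_index_def)
qed

text \<open>Raising \<open>j\<close> by one raises the index by at least \<open>r div 2\<close>,
  which exceeds \<open>s\<close>.\<close>

lemma p1_index_strict_mono:
  assumes "j < j'" "s < r div 2"
  shows "p1_index b r s j < p1_index b r s' j'"
proof -
  have "Suc j * r \<le> j' * r" using assms by (intro mult_le_mono1) simp
  then have "r + j * r \<le> j' * r" by simp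
  moreover have "r div 2 + (1 + z) div 2 \<le> (1 + u) div 2" if "r + z \<le> u" for z u :: nat
    using that by presburger
  ultimately have "r div 2 + (1 + j * r) div 2 \<le> (1 + j' * r) div 2" by blast
  then show ?thesis using assms by (simp add: p1_index_def)
qed

text \<open>Repetitions in different pairs of classes therefore force different letters.\<close>

lemma p1_index_inj:
  assumes "p1_index b r s j = p1_index b r s' j'" "s < r div 2" "s' < r div 2"
  shows "s = s'"
proof (cases j j' rule: linorder_cases)
  case equal
  then show ?thesis using assms(1) by (simp add: p1_index_def)
qed (use assms p1_index_strict_mono in \<open>metis less_irrefl\<close>)+

text \<open>For odd \<open>r\<close>, Player 1 owns the terms with even \<open>j\<close> in the
  first class and those with odd \<open>j\<close> in the second; prismatic pairs reflect this
  alternation.\<close>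

lemma p1_position:
  "even r \<Longrightarrow> 2 * p1_index b r s j + 1 = 2 * b + 1 + 2 * s + j * r"
  "odd r \<Longrightarrow> 2 * p1_index b r s j + 1 = 2 * b + 1 + 2 * s + j * r + (if odd j then 1 else 0)"
proof -
  have "2 * ((1 + z) div 2) = z + (if odd z then 1 else 0)" for z :: nat by presburger
  from this[of "j * r"] show
    "even r \<Longrightarrow> 2 * p1_index b r s j + 1 = 2 * b + 1 + 2 * s + j * r"
    "odd r \<Longrightarrow> 2 * p1_index b r s j + 1 = 2 * b + 1 + 2 * s + j * r + (if odd j then 1 else 0)"
    unfolding p1_index_def by (simp_all add: algebra_simps del: mult_Suc mult_Suc_right)
qed

lemma repeats_cong:
  assumes "\<And>p. 1 \<le> p \<Longrightarrow> p \<le> 2 * (b + k * r div 2) \<Longrightarrow> \<chi> p = \<psi> p"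
  shows "repeats \<chi> k b r \<longleftrightarrow> repeats \<psi> k b r"
proof -
  have "\<chi> (2 * p1_index b r s j + 1 - (j - i) * r) = \<psi> (2 * p1_index b r s j + 1 - (j - i) * r) \<and>
      \<chi> (2 * p1_index b r s j + 1) = \<psi> (2 * p1_index b r s j + 1)"
    if "s < r div 2" "i < j" "j < k" for s i j
  proof -
    \<comment> \<open>The subtraction does not truncate, so position 0 is never inspected.\<close>
    have "(j - i) * r \<le> j * r" by simp
    moreover have "j * r \<le> 2 * p1_index b r s j" by (simp add: p1_index_def)
    ultimately have "1 \<le> 2 * p1_index b r s j + 1 - (j - i) * r" by linarith
    then show ?thesis
      using p1_index_less[OF that(3,1), of b] by (auto intro!: assms)
  qed
  then show ?thesis unfolding repeats_def by metis
qed

lemma good_take: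
  assumes "good k h"
  shows "good k (take m h)"
  unfolding good_def
proof (intro allI impI)
  fix b r assume *: "2 \<le> r \<and> 2 * (b + k * r div 2) \<le> length (take m h)"
  then have "repeats (\<lambda>p. take m h ! (p - 1)) k b r \<longleftrightarrow> repeats (\<lambda>p. h ! (p - 1)) k b r"
    by (intro repeats_cong) auto
  then show "\<not> repeats (\<lambda>p. take m h ! (p - 1)) k b r"
    using assms * by (auto simp: good_def)
qed

section \<open>Counting\<close>

lemma finite_words: "finite {w. length w = n \<and> set w \<subseteq> {..<c::nat} \<and> Q w}"
  by (rule finite_subset[OF _ finite_lists_length_eq[of "{..<c}" n]]) auto

text \<open>Append letters one at a time: a free letter multiplies the count by at most
  \<open>c\<close>, a forced one by at most 1, since the prefix determines it.\<close>

lemma card_forced_words: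
  assumes "finite P" "F \<subseteq> {n0..}"
  shows "card {w. length w = n0 + m \<and> set w \<subseteq> {..<c} \<and> take n0 w \<in> P \<and>
      (\<forall>v\<in>F. v < n0 + m \<longrightarrow> w ! v = g v (take v w))} * c ^ card (F \<inter> {..<n0 + m}) \<le> card P * c ^ m"
    (is "card (?W m) * c ^ card (?F m) \<le> _")
proof (induction m)
  case 0
  have "?F 0 = {}" using assms(2) by auto
  moreover have "card (?W 0) \<le> card P" using assms(1) by (intro card_mono) auto
  ultimately show ?case by simp
next
  case (Suc m)
  have butlast_in: "butlast w \<in> ?W m" if "w \<in> ?W (Suc m)" for w
  proof -
    have "butlast w = take (n0 + m) w" using that by (simp add: butlast_conv_take)
    then show ?thesis using that by (auto simp: min_def dest: in_set_takeD)
  qed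
  have snoc: "w = butlast w @ [w ! (n0 + m)]" if "w \<in> ?W (Suc m)" for w
    using that by (simp add: butlast_conv_take flip: take_Suc_conv_app_nth)
  have fin: "finite (?W m)" by (rule finite_words)
  show ?case
  proof (cases "n0 + m \<in> F")
    case True
    have "inj_on butlast (?W (Suc m))"
    proof (rule inj_onI)
      fix u w assume uw: "u \<in> ?W (Suc m)" "w \<in> ?W (Suc m)" "butlast u = butlast w"
      then have "take (n0 + m) u = take (n0 + m) w" by (simp add: butlast_conv_take)
      moreover have "u ! (n0 + m) = g (n0 + m) (take (n0 + m) u)"
        "w ! (n0 + m) = g (n0 + m) (take (n0 + m) w)"
        using uw(1,2) True by simp_all
      ultimately have "u ! (n0 + m) = w ! (n0 + m)" by simp
      then show "u = w" using snoc[OF uw(1)] snoc[OF uw(2)] uw(3) by metis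
    qed
    then have "card (?W (Suc m)) \<le> card (?W m)"
      using butlast_in fin by (intro card_inj_on_le[of butlast]) auto
    moreover have "?F (Suc m) = insert (n0 + m) (?F m)" using True by (auto simp: less_Suc_eq)
    then have "card (?F (Suc m)) = Suc (card (?F m))" by simp
    ultimately have "card (?W (Suc m)) * c ^ card (?F (Suc m)) \<le> card (?W m) * c ^ card (?F m) * c"
      by (simp add: mult.commute mult.left_commute)
    also have "\<dots> \<le> card P * c ^ m * c" using Suc.IH by (rule mult_le_mono1)
    finally show ?thesis by (simp add: ac_simps)
  next
    case False
    let ?f = "\<lambda>w. (butlast w, w ! (n0 + m))"
    have "inj_on ?f (?W (Suc m))"
    proof (rule inj_onI)
      fix u w assume uw: "u \<in> ?W (Suc m)" "w \<in> ?W (Suc m)" "?f u = ?f w"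
      then show "u = w" using snoc[OF uw(1)] snoc[OF uw(2)] by (metis prod.inject)
    qed
    moreover have "?f ` ?W (Suc m) \<subseteq> ?W m \<times> {..<c}"
    proof
      fix z assume "z \<in> ?f ` ?W (Suc m)"
      then obtain w where w: "w \<in> ?W (Suc m)" "z = ?f w" by blast
      then have "w ! (n0 + m) \<in> set w" by simp
      then have "w ! (n0 + m) < c" using w by blast
      then show "z \<in> ?W m \<times> {..<c}" using butlast_in[OF w(1)] w(2) by blast
    qed
    ultimately have "card (?W (Suc m)) \<le> card (?W m \<times> {..<c})"
      using fin by (intro card_inj_on_le) auto
    moreover have "?F (Suc m) = ?F m" using False by (auto simp: less_Suc_eq)
    ultimately have "card (?W (Suc m)) * c ^ card (?F (Suc m)) \<le> card (?W m) * c ^ card (?F m) * c"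
      by (simp add: card_cartesian_product mult.commute mult.left_commute)
    also have "\<dots> \<le> card P * c ^ m * c" using Suc.IH by (rule mult_le_mono1)
    finally show ?thesis by (simp add: ac_simps)
  qed
qed

section \<open>Words of Player 1 against a fixed strategy of Player 2\<close>

definition good_words :: "nat \<Rightarrow> nat \<Rightarrow> (nat list \<Rightarrow> nat) \<Rightarrow> nat \<Rightarrow> nat list set" where
  "good_words c k \<tau> n = {w. length w = n \<and> set w \<subseteq> {..<c} \<and> good k (play \<tau> w)}"

lemma finite_good_words: "finite (good_words c k \<tau> n)"
  unfolding good_words_def by (rule finite_words)

lemma good_words_take:
  assumes "w \<in> good_words c k \<tau> n" "m \<le> n"
  shows "take m w \<in> good_words c k \<tau> m"
  using assms good_take[of k "play \<tau> w" "2 * m"]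
  by (auto simp: good_words_def take_play dest: in_set_takeD)

text \<open>Goodness is asked only of the prefix before any forced letter: this ties the count to an
  earlier \<open>good_words\<close> and leaves the later letters to
  \<open>card_forced_words\<close>.\<close>

definition repeating_words :: "nat \<Rightarrow> nat \<Rightarrow> (nat list \<Rightarrow> nat) \<Rightarrow> nat \<Rightarrow> nat \<Rightarrow> nat list set" where
  "repeating_words c k \<tau> b r = {w. length w = b + k * r div 2 \<and> set w \<subseteq> {..<c} \<and>
     take (b + (r + 1) div 2) w \<in> good_words c k \<tau> (b + (r + 1) div 2) \<and>
     repeats (\<lambda>p. play \<tau> w ! (p - 1)) k b r}"

text \<open>In the play, the earlier of two equally coloured positions of a repetition
  dictates the colour at the later one, which is Player 1's. Hence \<open>r div 2\<close> of the last
  letters of a repeating word are determined by the ones before them.\<close>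

lemma card_repeating_words:
  assumes "k \<ge> 2"
  shows "card (repeating_words c k \<tau> b r) * c ^ (r div 2)
    \<le> (\<Sum>{..<k}) ^ (r div 2) * (card (good_words c k \<tau> (b + (r + 1) div 2)) * c ^ (k * r div 2 - (r + 1) div 2))"
proof -
  define n0 where "n0 = b + (r + 1) div 2"
  define m where "m = k * r div 2 - (r + 1) div 2"
  define t where "t = r div 2"
  define pairs where "pairs = (SIGMA j:{..<k}. {..<j})"
  define idx where "idx f s = p1_index b r s (fst (f s))" for f :: "nat \<Rightarrow> nat \<times> nat" and s
  \<comment> \<open>\<open>g\<close> recovers the pair of classes from the forced index by inverting
    \<open>idx f\<close>, then reads the dictating colour off the play of the shorter word.\<close>
  define g where "g f v u = (let s = inv_into {..<t} (idx f) v
    in play \<tau> u ! (2 * v - (fst (f s) - snd (f s)) * r))" for f v u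
  define W where "W f = {w. length w = n0 + m \<and> set w \<subseteq> {..<c} \<and> take n0 w \<in> good_words c k \<tau> n0 \<and>
      (\<forall>v\<in>idx f ` {..<t}. v < n0 + m \<longrightarrow> w ! v = g f v (take v w))}" for f
  have "2 * r \<le> k * r" using assms by simp
  then have nm: "b + k * r div 2 = n0 + m" unfolding n0_def m_def by linarith
  have inj: "inj_on (idx f) {..<t}" for f
    by (rule inj_onI) (auto simp: idx_def t_def intro: p1_index_inj)
  have fin: "finite pairs" and card_pairs: "card pairs = \<Sum>{..<k}"
    by (simp_all add: pairs_def)
  have cardW: "card (W f) * c ^ t \<le> card (good_words c k \<tau> n0) * c ^ m"
    if f: "f \<in> {..<t} \<rightarrow>\<^sub>E pairs" for f
  proof -
    have f_s: "1 \<le> fst (f s)" "fst (f s) < k" if "s < t" for s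
      using PiE_mem[OF f, of s] that by (auto simp: pairs_def)
    have F: "idx f ` {..<t} \<subseteq> {n0..}"
      using f_s p1_index_ge by (auto simp: idx_def n0_def)
    have "idx f ` {..<t} \<subseteq> {..<n0 + m}"
      unfolding nm[symmetric] using f_s p1_index_less by (auto simp: idx_def t_def)
    then have eq_t: "card (idx f ` {..<t} \<inter> {..<n0 + m}) = t"
      using card_image[OF inj] by (simp add: inf.absorb1)
    then show ?thesis
      using card_forced_words[OF finite_good_words[of c k \<tau> n0] F, where g = "g f" and c = c and m = m]
      unfolding W_def by (simp only: eq_t)
  qed
  \<comment> \<open>Union bound over the choice functions \<open>f\<close>, which select one
    repetition \<open>(j, i)\<close> for each pair of classes.\<close>
  have "repeating_words c k \<tau> b r \<subseteq> (\<Union>f\<in>{..<t} \<rightarrow>\<^sub>E pairs. W f)"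
  proof
    fix w assume w: "w \<in> repeating_words c k \<tau> b r"
    then have len: "length w = n0 + m" by (simp add: repeating_words_def nm)
    have "\<forall>s. \<exists>p. s < t \<longrightarrow> p \<in> pairs \<and> play \<tau> w ! (2 * p1_index b r s (fst p) - (fst p - snd p) * r)
        = play \<tau> w ! (2 * p1_index b r s (fst p))"
    proof
      fix s
      show "\<exists>p. s < t \<longrightarrow> p \<in> pairs \<and> play \<tau> w ! (2 * p1_index b r s (fst p) - (fst p - snd p) * r)
        = play \<tau> w ! (2 * p1_index b r s (fst p))"
      proof (cases "s < t")
        case True
        then obtain i j where "i < j" "j < k"
          "play \<tau> w ! (2 * p1_index b r s j + 1 - (j - i) * r - 1) = play \<tau> w ! (2 * p1_index b r s j + 1 - 1)"
          using w unfolding repeating_words_def repeats_def t_def by blast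
        then have "(j, i) \<in> pairs \<and> play \<tau> w ! (2 * p1_index b r s j - (j - i) * r)
            = play \<tau> w ! (2 * p1_index b r s j)"
          by (simp add: pairs_def)
        then show ?thesis by (intro exI[of _ "(j, i)"]) simp
      qed simp
    qed
    then obtain f where f: "\<And>s. s < t \<Longrightarrow> f s \<in> pairs \<and>
        play \<tau> w ! (2 * idx f s - (fst (f s) - snd (f s)) * r) = play \<tau> w ! (2 * idx f s)"
      unfolding idx_def by metis
    define f' where "f' = restrict f {..<t}"
    have idx': "idx f' s = idx f s" if "s < t" for s using that by (simp add: idx_def f'_def)
    have "f' \<in> {..<t} \<rightarrow>\<^sub>E pairs" using f by (auto simp: f'_def)
    moreover have "w ! v = g f' v (take v w)" if v: "v \<in> idx f' ` {..<t}" "v < n0 + m" for v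
    proof -
      obtain s where s: "s < t" "v = idx f' s" using v by blast
      then have inv: "inv_into {..<t} (idx f') v = s" using inv_into_f_f[OF inj, of s f'] by simp
      obtain j i where ji: "f s = (j, i)" "i < j" "j < k" using f[OF s(1)] by (auto simp: pairs_def)
      have vj: "v = idx f s" using s idx' by simp
      then have "v \<ge> n0" using p1_index_ge[of j b r s] ji by (simp add: idx_def n0_def)
      have "r > 0" using s(1) by (cases r) (auto simp: t_def)
      \<comment> \<open>The dictating list index precedes \<open>2 * v\<close>, hence lies in the
        play of the first \<open>v\<close> letters, all that \<open>g\<close> sees.\<close>
      then have lt: "2 * v - (j - i) * r < 2 * v" using ji \<open>v \<ge> n0\<close> by (auto simp: n0_def)
      have "g f' v (take v w) = take (2 * v) (play \<tau> w) ! (2 * v - (j - i) * r)"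
        using inv ji s v(2) len by (simp add: g_def take_play f'_def)
      also have "\<dots> = play \<tau> w ! (2 * v - (j - i) * r)" using lt by simp
      also have "\<dots> = play \<tau> w ! (2 * v)" using f[OF s(1)] ji vj by simp
      also have "\<dots> = w ! v" using v(2) len by (simp add: play_nth_even)
      finally show ?thesis by simp
    qed
    then have "w \<in> W f'" using w unfolding W_def repeating_words_def n0_def[symmetric] nm by simp
    ultimately show "w \<in> (\<Union>f\<in>{..<t} \<rightarrow>\<^sub>E pairs. W f)" by blast
  qed
  moreover have "finite (\<Union>f\<in>{..<t} \<rightarrow>\<^sub>E pairs. W f)"
    unfolding W_def using fin by (intro finite_UN_I finite_PiE finite_words) auto
  ultimately have "card (repeating_words c k \<tau> b r) \<le> card (\<Union>f\<in>{..<t} \<rightarrow>\<^sub>E pairs. W f)"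
    by (rule card_mono[rotated])
  also have "\<dots> \<le> (\<Sum>f\<in>{..<t} \<rightarrow>\<^sub>E pairs. card (W f))"
    using fin by (intro card_UN_le finite_PiE) auto
  finally have "card (repeating_words c k \<tau> b r) * c ^ t \<le> (\<Sum>f\<in>{..<t} \<rightarrow>\<^sub>E pairs. card (W f) * c ^ t)"
    unfolding sum_distrib_right[symmetric] by (rule mult_le_mono1)
  also have "\<dots> \<le> (\<Sum>f\<in>{..<t} \<rightarrow>\<^sub>E pairs. card (good_words c k \<tau> n0) * c ^ m)"
    by (intro sum_mono cardW)
  also have "\<dots> = card pairs ^ t * (card (good_words c k \<tau> n0) * c ^ m)"
    by (simp add: card_PiE)
  finally show ?thesis by (simp only: card_pairs n0_def m_def t_def)
qed

text \<open>A repetition new to the extended word must end in the last round, so \<open>r\<close>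
  alone determines \<open>b\<close>.\<close>

lemma extensions_cover:
  assumes "w \<in> good_words c k \<tau> n" "x < c" "k \<ge> 2"
  shows "w @ [x] \<in> good_words c k \<tau> (Suc n) \<union>
    (\<Union>r\<in>{r. 2 \<le> r \<and> k * r div 2 \<le> Suc n}. repeating_words c k \<tau> (Suc n - k * r div 2) r)"
proof (cases "w @ [x] \<in> good_words c k \<tau> (Suc n)")
  case False
  have w: "length w = n" "set w \<subseteq> {..<c}" "good k (play \<tau> w)"
    using assms by (auto simp: good_words_def)
  then have "\<not> good k (play \<tau> (w @ [x]))" using False assms by (auto simp: good_words_def)
  then obtain b r where br: "r \<ge> 2" "2 * (b + k * r div 2) \<le> 2 * Suc n"
    "repeats (\<lambda>p. play \<tau> (w @ [x]) ! (p - 1)) k b r"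
    using w unfolding good_def by auto
  have "\<not> b + k * r div 2 \<le> n"
  proof
    assume le: "b + k * r div 2 \<le> n"
    have "play \<tau> (w @ [x]) ! (p - 1) = play \<tau> w ! (p - 1)" if "1 \<le> p" "p \<le> 2 * (b + k * r div 2)" for p
    proof -
      have "p - 1 < length (play \<tau> w)" using that le w by (simp; linarith)
      then show ?thesis by (simp add: nth_append)
    qed
    then have "repeats (\<lambda>p. play \<tau> (w @ [x]) ! (p - 1)) k b r \<longleftrightarrow> repeats (\<lambda>p. play \<tau> w ! (p - 1)) k b r"
      by (rule repeats_cong)
    then have "repeats (\<lambda>p. play \<tau> w ! (p - 1)) k b r" using br(3) by blast
    moreover have "2 \<le> r \<and> 2 * (b + k * r div 2) \<le> length (play \<tau> w)" using br(1) le w by simp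
    ultimately show False using w(3) unfolding good_def by blast
  qed
  then have "b + k * r div 2 = Suc n" using br(2) by simp
  then have b: "b = Suc n - k * r div 2" "k * r div 2 \<le> Suc n" "b + k * r div 2 = Suc n" by simp_all
  have "2 * r \<le> k * r" using assms by simp
  then have "r \<le> k * r div 2" by linarith
  \<comment> \<open>As \<open>r \<ge> 2\<close>, the prefix omits the new letter and inherits
    goodness from \<open>w\<close>.\<close>
  then have "b + (r + 1) div 2 \<le> n" using br(1) b(3) by linarith
  then have "take (b + (r + 1) div 2) (w @ [x]) \<in> good_words c k \<tau> (b + (r + 1) div 2)"
    using good_words_take[OF assms(1)] w(1) by simp
  then have "w @ [x] \<in> repeating_words c k \<tau> b r"
    using b(3) br w assms by (simp add: repeating_words_def)
  then show ?thesis using b br(1) by blast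
qed simp

text \<open>Rosenfeld's recursion: appending a letter is injective, and the union bound runs over
  the differences \<open>r\<close>.\<close>

lemma card_extensions:
  assumes "k \<ge> 2"
  shows "c * card (good_words c k \<tau> n) \<le> card (good_words c k \<tau> (Suc n)) +
    (\<Sum>r\<in>{r. 2 \<le> r \<and> k * r div 2 \<le> Suc n}. card (repeating_words c k \<tau> (Suc n - k * r div 2) r))"
proof -
  let ?R = "{r. 2 \<le> r \<and> k * r div 2 \<le> Suc n}"
  let ?B = "\<Union>r\<in>?R. repeating_words c k \<tau> (Suc n - k * r div 2) r"
  have "r \<le> Suc n" if "r \<in> ?R" for r
  proof -
    have "2 * r \<le> k * r" using assms by simp
    then show ?thesis using that by (simp; linarith)
  qed
  then have R: "finite ?R" by (meson finite_nat_set_iff_bounded_le)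
  have B: "finite ?B"
    unfolding repeating_words_def using R by (intro finite_UN_I finite_words)
  have "card (good_words c k \<tau> n \<times> {..<c}) \<le> card (good_words c k \<tau> (Suc n) \<union> ?B)"
  proof (rule card_inj_on_le[of "\<lambda>(w, x). w @ [x]"])
    show "(\<lambda>(w, x). w @ [x]) ` (good_words c k \<tau> n \<times> {..<c}) \<subseteq> good_words c k \<tau> (Suc n) \<union> ?B"
    proof
      fix z assume "z \<in> (\<lambda>(w, x). w @ [x]) ` (good_words c k \<tau> n \<times> {..<c})"
      then obtain w x where w: "w \<in> good_words c k \<tau> n" "x < c" "z = w @ [x]" by auto
      show "z \<in> good_words c k \<tau> (Suc n) \<union> ?B"
        using extensions_cover[OF w(1,2) assms] by (simp only: w(3))
    qed
    show "inj_on (\<lambda>(w, x). w @ [x]) (good_words c k \<tau> n \<times> {..<c})"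
      by (auto intro: inj_onI)
    show "finite (good_words c k \<tau> (Suc n) \<union> ?B)"
      using B finite_good_words by (rule finite_UnI[rotated])
  qed
  also have "\<dots> \<le> card (good_words c k \<tau> (Suc n)) + card ?B" by (rule card_Un_le)
  also have "card ?B \<le> (\<Sum>r\<in>?R. card (repeating_words c k \<tau> (Suc n - k * r div 2) r))"
    by (rule card_UN_le[OF R])
  finally show ?thesis by (simp add: card_cartesian_product mult.commute)
qed

section \<open>Estimates for the weights of the bad words\<close>

text \<open>Each \<open>t \<ge> 1\<close> arises from exactly two differences, 2t and 2t +
  1.\<close>

lemma sum_div_2:
  fixes f :: "nat \<Rightarrow> real" and T :: nat
  shows "(\<Sum>r=2..<2 * T + 2. f (r div 2)) = 2 * (\<Sum>t=1..T. f t)"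
proof (induction T)
  case (Suc T)
  have "(\<Sum>r=2..<2 * Suc T + 2. f (r div 2)) = (\<Sum>r=2..<2 * T + 2. f (r div 2)) + 2 * f (Suc T)"
    by simp
  then show ?case using Suc by simp
qed simp

lemma geometric_sum_le:
  fixes y :: real
  assumes "0 \<le> y" "y < 1"
  shows "(\<Sum>t=1..T. y ^ t) \<le> y / (1 - y)"
proof -
  have "(1 - y) * (\<Sum>t=1..T. y ^ t) = y - y ^ Suc T"
  proof (induction T)
    case (Suc T)
    have "(1 - y) * (\<Sum>t=1..Suc T. y ^ t) = (1 - y) * (\<Sum>t=1..T. y ^ t) + (1 - y) * y ^ Suc T"
      by (simp add: distrib_left)
    also have "\<dots> = y - y ^ Suc (Suc T)"
      unfolding Suc by (simp add: algebra_simps)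
    finally show ?case .
  qed simp
  then have "(1 - y) * (\<Sum>t=1..T. y ^ t) \<le> y" using assms by simp
  then show ?thesis using assms by (simp add: field_simps)
qed

text \<open>Bernoulli's inequality bounds the power below by 1 - (k - 1)/(2k) = (k +
  1)/(2k).\<close>

lemma inverse_power_bound:
  assumes "k \<ge> 2"
  shows "1 / (1 - 1 / (2 * real k)) ^ (k - 1) \<le> 2 * real k / (real k + 1)"
proof -
  have "1 + real (k - 1) * (- (1 / (2 * real k))) \<le> (1 + - (1 / (2 * real k))) ^ (k - 1)"
    using assms by (intro Bernoulli_inequality) simp
  moreover have "1 + real (k - 1) * (- (1 / (2 * real k))) = (real k + 1) / (2 * real k)"
    using assms by (simp add: field_simps)
  ultimately have "(real k + 1) / (2 * real k) \<le> (1 - 1 / (2 * real k)) ^ (k - 1)" by simp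
  then have "1 / (1 - 1 / (2 * real k)) ^ (k - 1) \<le> 1 / ((real k + 1) / (2 * real k))"
    using assms by (intro divide_left_mono) (auto intro!: mult_pos_pos zero_less_power)
  then show ?thesis by simp
qed

text \<open>With \<open>K = k\<close>, this limits the bad extensions to the fraction 1/(2k), the
  loss allowed in \<open>good_words_growth\<close>.\<close>

lemma weights_bound:
  fixes u x K :: real
  assumes "K \<ge> 2" "0 \<le> u" "u \<le> 2 * K / (K + 1)" "0 \<le> x" "x \<le> 1 / (16 * K)"
  shows "2 * (\<Sum>t=1..T. u * (u * x) ^ t) \<le> 1 / (2 * K)"
proof -
  have "u * x \<le> (2 * K / (K + 1)) * (1 / (16 * K))" using assms by (intro mult_mono) auto
  also have "\<dots> = 1 / (8 * (K + 1))" using assms(1) by (simp add: divide_simps)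
  finally have y: "u * x \<le> 1 / (8 * (K + 1))" .
  have y1: "1 / (8 * (K + 1)) < 1" using assms(1) by (simp add: field_simps)
  then have y2: "u * x < 1" using y by linarith
  have "2 * (\<Sum>t=1..T. u * (u * x) ^ t) = 2 * u * (\<Sum>t=1..T. (u * x) ^ t)"
    by (simp add: sum_distrib_left mult.assoc)
  also have "\<dots> \<le> 2 * u * (u * x / (1 - u * x))"
    using assms y2 by (intro mult_left_mono geometric_sum_le) auto
  also have "\<dots> \<le> 2 * (2 * K / (K + 1)) * ((1 / (8 * (K + 1))) / (1 - 1 / (8 * (K + 1))))"
    using assms y y1 y2 by (intro mult_mono frac_le) auto
  also have "\<dots> = 4 * K / ((K + 1) * (8 * K + 7))"
    using assms(1) by (simp add: divide_simps)
  \<comment> \<open>This amounts to 8K^2 \<le> 8K^2 + 15K + 7.\<close>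
  also have "\<dots> \<le> 1 / (2 * K)"
    using assms(1) by (simp add: divide_simps) (simp add: algebra_simps)
  finally show ?thesis .
qed

text \<open>By induction, the count at an earlier \<open>n0\<close> is at most the count at
  \<open>n\<close> divided by (cd)^(n - n0). Each bad term of \<open>card_extensions\<close> thus
  becomes a multiple of \<open>c * G n\<close>, and the weights are summable.\<close>

lemma good_words_growth:
  assumes k: "k \<ge> 2" and c: "8 * real k ^ 2 * (real k - 1) \<le> real c"
  shows "real c * (1 - 1 / (2 * real k)) * card (good_words c k \<tau> n) \<le> card (good_words c k \<tau> (Suc n))"
proof (induction n rule: less_induct)
  case (less n)
  define G where "G n = real (card (good_words c k \<tau> n))" for n
  define d where "d = 1 - 1 / (2 * real k)"
  \<comment> \<open>\<open>x\<close> weighs one forced letter: the number of repetition types per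
    pair of classes, over \<open>c\<close>. \<open>u\<close> is the loss when k - 1 letters grow by
    \<open>c * d\<close> instead of \<open>c\<close>.\<close>
  define x where "x = real (\<Sum>{..<k}) / real c"
  define u where "u = 1 / d ^ (k - 1)"
  define R where "R = {r. 2 \<le> r \<and> k * r div 2 \<le> Suc n}"
  have "0 < 8 * real k ^ 2 * (real k - 1)" using k by simp
  then have c0: "real c > 0" using c by linarith
  have d: "0 < d" "d \<le> 1" using k by (auto simp: d_def field_simps)
  have "2 * \<Sum>{..<k} = k * (k - 1)"
    by (induction k) (auto simp: algebra_simps)
  then have "2 * real (\<Sum>{..<k}) = real k * (real k - 1)"
    using k by (metis (no_types, lifting) of_nat_1 of_nat_diff of_nat_mult of_nat_numeral le_trans one_le_numeral)
  then have x: "x = real k * (real k - 1) / (2 * real c)"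
    using c0 by (simp add: x_def field_simps del: of_nat_sum)
  have x0: "0 \<le> x" using k by (simp add: x)
  have "x * (16 * real k) = 8 * real k ^ 2 * (real k - 1) / real c"
    by (simp add: x power2_eq_square)
  also have "\<dots> \<le> 1" using c c0 by simp
  finally have x1: "x \<le> 1 / (16 * real k)" using k by (simp add: pos_le_divide_eq)
  have u0: "0 \<le> u" using d by (simp add: u_def)
  have growth: "(real c * d) ^ (n - n0) * G n0 \<le> G n" if "n0 \<le> n" for n0
  proof -
    have "(real c * d) ^ (m - n0) * G n0 \<le> G m" if "n0 \<le> m" "m \<le> n" for m
      using that
    proof (induction m rule: dec_induct)
      case (step m)
      have "(real c * d) ^ (Suc m - n0) * G n0 = real c * d * ((real c * d) ^ (m - n0) * G n0)"
        using step by (simp add: Suc_diff_le)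
      also have "\<dots> \<le> real c * d * G m" using step c0 d by (intro mult_left_mono) auto
      also have "\<dots> \<le> G (Suc m)" using less[of m] step by (simp add: G_def d_def)
      finally show ?case .
    qed simp
    then show ?thesis using that by blast
  qed
  have bad: "real (card (repeating_words c k \<tau> (Suc n - k * r div 2) r))
      \<le> real c * G n * (u * (u * x) ^ (r div 2))" if r: "r \<in> R" for r
  proof -
    define b where "b = Suc n - k * r div 2"
    define t where "t = r div 2"
    define n0 where "n0 = b + (r + 1) div 2"
    define m where "m = k * r div 2 - (r + 1) div 2"
    have "2 * r \<le> k * r" using k by simp
    then have "r \<le> k * r div 2" by linarith
    moreover have "2 \<le> r" using r by (simp add: R_def)
    then have "(r + 1) div 2 < r" by linarith
    ultimately have "1 \<le> m" unfolding m_def by linarith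
    have n: "n0 \<le> n" "n - n0 = m - 1"
      using \<open>1 \<le> m\<close> r by (auto simp: n0_def b_def m_def R_def)
    have "k * r \<le> k * (2 * t + 1)" unfolding t_def by (intro mult_le_mono2) linarith
    then have "k * r div 2 \<le> k * t + k div 2"
      by (metis (no_types, opaque_lifting) add.commute div_le_mono div_mult_self2 mult.left_commute
          distrib_left mult.right_neutral zero_neq_numeral)
    then have "m \<le> k * t + k div 2 - t" unfolding m_def t_def by linarith
    also have "\<dots> \<le> (k - 1) * (t + 1) + 1"
      using k by (simp add: algebra_simps diff_mult_distrib)
    finally have "m - 1 \<le> (k - 1) * (t + 1)" by simp
    then have "d ^ ((k - 1) * (t + 1)) \<le> d ^ (m - 1)" using d by (intro power_decreasing) auto
    then have "1 / d ^ (m - 1) \<le> 1 / d ^ ((k - 1) * (t + 1))"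
      using d by (intro divide_left_mono) auto
    also have "\<dots> = u ^ (t + 1)" by (simp only: u_def power_mult power_one_over)
    finally have du: "1 / d ^ (m - 1) \<le> u ^ (t + 1)" .
    \<comment> \<open>Since n0 + m = n + 1, the growth bound absorbs m - 1 of the m factors
      \<open>c\<close>; the last one stays in front.\<close>
    have "G n0 * real c ^ m = real c * ((real c * d) ^ (n - n0) * G n0) * (1 / d ^ (m - 1))"
      using \<open>1 \<le> m\<close> d c0 unfolding n(2)
      by (simp add: power_mult_distrib power_eq_if[of _ m])
    also have "\<dots> \<le> real c * G n * u ^ (t + 1)"
      using growth[OF n(1)] du c0 d by (intro mult_mono) (auto simp: G_def)
    finally have Gn0: "G n0 * real c ^ m \<le> real c * G n * u ^ (t + 1)" .
    have "real (card (repeating_words c k \<tau> b r) * c ^ t)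
        \<le> real ((\<Sum>{..<k}) ^ t * (card (good_words c k \<tau> n0) * c ^ m))"
      unfolding n0_def m_def t_def using card_repeating_words[OF k] by (rule of_nat_mono)
    then have "real (card (repeating_words c k \<tau> b r)) * real c ^ t
        \<le> real (\<Sum>{..<k}) ^ t * (G n0 * real c ^ m)"
      by (simp only: of_nat_mult of_nat_power G_def)
    also have "\<dots> \<le> real (\<Sum>{..<k}) ^ t * (real c * G n * u ^ (t + 1))"
      by (intro mult_left_mono Gn0 zero_le_power of_nat_0_le_iff)
    also have "real (\<Sum>{..<k}) ^ t = x ^ t * real c ^ t"
      using c0 by (simp add: x_def power_divide)
    finally have "real (card (repeating_words c k \<tau> b r)) * real c ^ t
        \<le> (real c * G n * (u * (u * x) ^ t)) * real c ^ t"
      by (simp add: power_mult_distrib ac_simps)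
    then show ?thesis using c0 by (simp add: b_def t_def)
  qed
  \<comment> \<open>Enlarging \<open>R\<close> to full pairs 2t, 2t + 1 adds only non-negative terms
    and makes \<open>sum_div_2\<close> applicable.\<close>
  have R: "R \<subseteq> {2..<2 * Suc n + 2}"
  proof
    fix r assume "r \<in> R"
    moreover have "2 * r \<le> k * r" using k by simp
    ultimately show "r \<in> {2..<2 * Suc n + 2}" by (simp add: R_def; linarith)
  qed
  have "real c * G n \<le> G (Suc n) + (\<Sum>r\<in>R. real (card (repeating_words c k \<tau> (Suc n - k * r div 2) r)))"
    using of_nat_mono[OF card_extensions[OF k, of c \<tau> n], where 'a = real] unfolding R_def G_def
    by simp
  also have "\<dots> \<le> G (Suc n) + (\<Sum>r\<in>R. real c * G n * (u * (u * x) ^ (r div 2)))"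
    by (intro add_left_mono sum_mono bad)
  also have "\<dots> = G (Suc n) + real c * G n * (\<Sum>r\<in>R. u * (u * x) ^ (r div 2))"
    by (simp add: sum_distrib_left)
  also have "\<dots> \<le> G (Suc n) + real c * G n * (\<Sum>r=2..<2 * Suc n + 2. u * (u * x) ^ (r div 2))"
    using u0 x0 R by (intro add_left_mono mult_left_mono sum_mono2) (auto simp: G_def)
  also have "(\<Sum>r=2..<2 * Suc n + 2. u * (u * x) ^ (r div 2)) = 2 * (\<Sum>t=1..Suc n. u * (u * x) ^ t)"
    by (rule sum_div_2)
  also have "G (Suc n) + real c * G n * \<dots> \<le> G (Suc n) + real c * G n * (1 / (2 * real k))"
    using k u0 x0 x1 inverse_power_bound[OF k]
    by (intro add_left_mono mult_left_mono weights_bound) (auto simp: G_def u_def d_def)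
  finally show ?case by (simp add: G_def algebra_simps)
qed

lemma good_word_exists:
  assumes k: "k \<ge> 2" and c: "8 * real k ^ 2 * (real k - 1) \<le> real c"
  shows "good_words c k \<tau> n \<noteq> {}"
proof -
  have "0 < 8 * real k ^ 2 * (real k - 1)" using k by simp
  then have "0 < real c" using c by linarith
  then have pos: "0 < real c * (1 - 1 / (2 * real k))" using k by (intro mult_pos_pos) auto
  have "0 < card (good_words c k \<tau> n)"
  proof (induction n)
    case 0
    have "\<not> 2 * (b + k * r div 2) \<le> 0" if "r \<ge> 2" for b r
    proof -
      have "2 * r \<le> k * r" using k by simp
      then have "r \<le> k * r div 2" by linarith
      then show ?thesis using that by simp
    qed
    then have "good k []" unfolding good_def list.size by blast
    then have "[] \<in> good_words c k \<tau> 0" by (simp add: good_words_def)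
    then show ?case using finite_good_words card_gt_0_iff by blast
  next
    case (Suc n)
    then have "0 < real c * (1 - 1 / (2 * real k)) * card (good_words c k \<tau> n)"
      by (intro mult_pos_pos[OF pos]) simp
    then show ?case using good_words_growth[OF k c, of \<tau> n] by linarith
  qed
  then show ?thesis by auto
qed

section \<open>Progressions in repetition-free sequences\<close>

lemma not_repeatsE:
  assumes "\<not> repeats \<chi> k b r"
  obtains s where "s < r div 2" "\<And>i j. i < j \<Longrightarrow> j < k \<Longrightarrow>
    \<chi> (2 * p1_index b r s j + 1 - (j - i) * r) \<noteq> \<chi> (2 * p1_index b r s j + 1)"
  using assms unfolding repeats_def by blast

text \<open>For even \<open>r\<close>, every term of the progression from the odd position
  \<open>f\<close> is Player 1's, so excluding repetitions at his positions gives full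
  injectivity.\<close>

lemma rainbow_ap_of_not_repeats:
  assumes nr: "\<not> repeats \<chi> k (a div 2) r" and "even r" "k * r \<le> l"
  shows "contains_rainbow_ap \<chi> k r (block a l)"
proof -
  obtain s where s: "s < r div 2" "\<And>i j. i < j \<Longrightarrow> j < k \<Longrightarrow>
    \<chi> (2 * p1_index (a div 2) r s j + 1 - (j - i) * r) \<noteq> \<chi> (2 * p1_index (a div 2) r s j + 1)"
    using not_repeatsE[OF nr] by blast
  \<comment> \<open>\<open>2 * (a div 2) + 1\<close> is the first odd position from \<open>a\<close>
    on. Terms of \<open>\<alpha>\<close> are indexed from 1, those of \<open>p1_index\<close> from
    0.\<close>
  define f where "f = 2 * (a div 2) + 1 + 2 * s"
  define \<alpha> where "\<alpha> i = f + (i - 1) * r" for i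
  have neq: "\<chi> (\<alpha> i) \<noteq> \<chi> (\<alpha> j)" if "1 \<le> i" "i < j" "j \<le> k" for i j
  proof -
    have "2 * p1_index (a div 2) r s (j - 1) + 1 = \<alpha> j"
      using p1_position(1)[OF \<open>even r\<close>] by (simp add: \<alpha>_def f_def)
    moreover have "(j - 1) * r = (i - 1) * r + ((j - 1) - (i - 1)) * r"
      using that by (simp flip: add_mult_distrib)
    then have "\<alpha> j - ((j - 1) - (i - 1)) * r = \<alpha> i" by (simp add: \<alpha>_def)
    ultimately show ?thesis using s(2)[of "i - 1" "j - 1"] that by simp
  qed
  have "inj_on \<chi> (\<alpha> ` {1..k})"
  proof (rule inj_onI)
    fix p q assume "p \<in> \<alpha> ` {1..k}" "q \<in> \<alpha> ` {1..k}" "\<chi> p = \<chi> q"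
    then obtain i j where "i \<in> {1..k}" "j \<in> {1..k}" "p = \<alpha> i" "q = \<alpha> j" "\<chi> (\<alpha> i) = \<chi> (\<alpha> j)" by blast
    then show "p = q" using neq[of i j] neq[of j i] by (cases i j rule: linorder_cases) auto
  qed
  moreover have "i * r = (i - 1) * r + r" if "i \<ge> 1" for i
    using that by (cases i) auto
  then have "arith_prog k r \<alpha>"
    by (auto simp: arith_prog_def \<alpha>_def f_def)
  moreover have "\<alpha> ` {1..k} \<subseteq> block a l"
  proof
    fix p assume "p \<in> \<alpha> ` {1..k}"
    then obtain i where i: "i \<in> {1..k}" "p = \<alpha> i" by blast
    have "Suc (i - 1) * r \<le> k * r" using i by (intro mult_le_mono1) auto
    then show "p \<in> block a l"
      using i s(1) \<open>k * r \<le> l\<close> \<open>even r\<close> by (auto simp: block_def \<alpha>_def f_def elim!: evenE)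
  qed
  ultimately show ?thesis unfolding contains_rainbow_ap_def rainbow_ap_def by blast
qed

lemma prismatic_pair_of_not_repeats:
  assumes nr: "\<not> repeats \<chi> k (a div 2) r" and "odd r" "k * r \<le> l"
  shows "contains_prismatic_pair \<chi> k r (block a l)"
proof -
  obtain s where s: "s < r div 2" "\<And>i j. i < j \<Longrightarrow> j < k \<Longrightarrow>
    \<chi> (2 * p1_index (a div 2) r s j + 1 - (j - i) * r) \<noteq> \<chi> (2 * p1_index (a div 2) r s j + 1)"
    using not_repeatsE[OF nr] by blast
  define f where "f = 2 * (a div 2) + 1 + 2 * s"
  define \<gamma> where "\<gamma> e i = f + e + (i - 1) * r" for e i
  have "odd f" by (simp add: f_def)
  have neq: "\<chi> (\<gamma> e i) \<noteq> \<chi> (\<gamma> e j)"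
    if "i \<in> {1..k}" "j \<in> {1..k}" "e < 2" "\<gamma> e i < \<gamma> e j" "odd (\<gamma> e j)" for e i j
  proof -
    have "(i - 1) * r < (j - 1) * r" using that(4) by (simp add: \<gamma>_def)
    then have ij: "i - 1 < j - 1" by simp
    \<comment> \<open>As \<open>f\<close> and \<open>r\<close> are odd, \<open>\<gamma> e j\<close>
      is odd only if \<open>e\<close> and \<open>j - 1\<close> have equal parity;
      \<open>p1_index\<close> then picks this very term.\<close>
    have "e = (if odd (j - 1) then 1 else 0)"
      using that(3,5) \<open>odd f\<close> \<open>odd r\<close> by (auto simp: \<gamma>_def less_2_cases_iff)
    then have "2 * p1_index (a div 2) r s (j - 1) + 1 = \<gamma> e j"
      using p1_position(2)[OF \<open>odd r\<close>, of "a div 2" s "j - 1"] by (simp add: \<gamma>_def f_def)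
    moreover have "(j - 1) * r = (i - 1) * r + ((j - 1) - (i - 1)) * r"
      using ij by (simp flip: add_mult_distrib)
    then have "\<gamma> e j - ((j - 1) - (i - 1)) * r = \<gamma> e i" by (simp add: \<gamma>_def)
    moreover have "j - 1 < k" using that(2) by (simp; linarith)
    ultimately show ?thesis using s(2)[OF ij] by simp
  qed
  have "i * r = (i - 1) * r + r" if "i \<ge> 1" for i
    using that by (cases i) auto
  then have ap: "arith_prog k r (\<gamma> e)" for e
    by (auto simp: arith_prog_def \<gamma>_def f_def)
  have blk: "\<gamma> e ` {1..k} \<subseteq> block a l" if "e < 2" for e
  proof
    fix p assume "p \<in> \<gamma> e ` {1..k}"
    then obtain i where i: "i \<in> {1..k}" "p = \<gamma> e i" by blast
    have "Suc (i - 1) * r \<le> k * r" using i by (intro mult_le_mono1) auto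
    \<comment> \<open>For odd \<open>r\<close>, 2s \<le> r - 3 leaves room for both the shift to an
      odd start and the shift by \<open>e\<close>.\<close>
    then show "p \<in> block a l"
      using i s(1) that \<open>k * r \<le> l\<close> \<open>odd r\<close> by (auto simp: block_def \<gamma>_def f_def elim!: oddE)
  qed
  have "prismatic_pair \<chi> k r (\<gamma> 0) (\<gamma> 1)"
    unfolding prismatic_pair_def using ap neq[of _ _ 0] neq[of _ _ 1] by (auto simp: \<gamma>_def)
  then show ?thesis
    unfolding contains_prismatic_pair_def using blk[of 0] blk[of 1] by force
qed

text \<open>Player 1's term with index \<open>j\<close> has some offset \<open>x\<close> in its
  block; the term (j - i)r earlier has the same offset in the other block and a different
  colour.\<close>

lemma block_words_differ:
  assumes nr: "\<not> repeats \<chi> k (a div 2) r" and "i < j" "j < k"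
  shows "block_word \<chi> (a + i * r) r \<noteq> block_word \<chi> (a + j * r) r"
proof
  assume eq: "block_word \<chi> (a + i * r) r = block_word \<chi> (a + j * r) r"
  obtain s where s: "s < r div 2" "\<And>i j. i < j \<Longrightarrow> j < k \<Longrightarrow>
    \<chi> (2 * p1_index (a div 2) r s j + 1 - (j - i) * r) \<noteq> \<chi> (2 * p1_index (a div 2) r s j + 1)"
    using not_repeatsE[OF nr] by blast
  obtain x where x: "x < r" "2 * p1_index (a div 2) r s j + 1 = a + j * r + x"
  proof (cases "even r")
    case True
    have "2 * (a div 2) + 1 + 2 * s - a < r" using s(1) True by (auto elim!: evenE)
    moreover have "a \<le> 2 * (a div 2) + 1 + 2 * s" by linarith
    ultimately show ?thesis
      using that[of "2 * (a div 2) + 1 + 2 * s - a"] p1_position(1)[OF True, of "a div 2" s j] by simp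
  next
    case False
    let ?e = "if odd j then 1 else 0 :: nat"
    have "2 * (a div 2) + 1 + 2 * s + ?e - a < r" using s(1) False by (auto elim!: oddE)
    moreover have "a \<le> 2 * (a div 2) + 1 + 2 * s" by linarith
    ultimately show ?thesis
      using that[of "2 * (a div 2) + 1 + 2 * s + ?e - a"] p1_position(2)[OF False, of "a div 2" s j] by simp
  qed
  have "a + j * r + x - (j - i) * r = a + i * r + x"
    using assms(2) by (simp add: diff_mult_distrib)
  then have "\<chi> (a + i * r + x) \<noteq> \<chi> (a + j * r + x)" using s(2)[OF assms(2,3)] x(2) by simp
  moreover have "block_word \<chi> (a + i * r) r ! x = block_word \<chi> (a + j * r) r ! x" using eq by simp
  ultimately show False using x(1) by (simp add: block_word_def)
qed

section \<open>The constants and the final assembly\<close>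

text \<open>Yields 8 \<le> 3e. The quadratic Taylor bound at 1 or 1/2 gives only 2.5 or about 2.64,
  hence the fourth power of the bound at 1/4.\<close>

lemma exp_1_ge: "8 / 3 \<le> exp (1 :: real)"
proof -
  have "(41 / 32 :: real) \<le> exp (1 / 4)"
    using exp_lower_Taylor_quadratic[of "1 / 4 :: real"] by (simp add: power2_eq_square)
  then have "(41 / 32 :: real) ^ 4 \<le> exp (1 / 4) ^ 4" by (intro power_mono) auto
  also have "exp (1 / 4 :: real) ^ 4 = exp 1" by (simp flip: exp_of_nat_mult)
  finally show ?thesis by (simp add: power4_eq_xxxx)
qed

theorem theorem5p3:
  "\<exists>C :: nat \<Rightarrow> real.
     C 2 = 37 \<and>
     limsup (\<lambda>k. ereal (C k / (3 * exp 1 * real k ^ 3))) \<le> 1 \<and>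
     (\<forall>k c :: nat. k \<ge> 2 \<and> real c \<ge> C k \<longrightarrow>
        (\<exists>\<sigma>. player1_strategy c \<sigma> \<and>
           ensures c \<sigma> (\<lambda>\<chi>.
             (\<forall>r\<ge>2. \<forall>a\<ge>1. \<forall>l\<ge>k * r.
                (even r \<longrightarrow> contains_rainbow_ap \<chi> k r (block a l)) \<and>
                (odd r \<longrightarrow> contains_prismatic_pair \<chi> k r (block a l))) \<and>
             (\<forall>r\<ge>2. \<forall>a\<ge>1. \<forall>i<k. \<forall>j<k. i \<noteq> j \<longrightarrow>
                block_word \<chi> (a + i * r) r \<noteq> block_word \<chi> (a + j * r) r))))"
proof -
  \<comment> \<open>At \<open>k = 2\<close> the counting asks for 32, below 37; elsewhere 8k^3
    dominates 8k^2(k - 1). The limsup ignores the exceptional value.\<close>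
  define C :: "nat \<Rightarrow> real" where "C k = (if k = 2 then 37 else 8 * real k ^ 3)" for k
  have "C k / (3 * exp 1 * real k ^ 3) \<le> 1" if "k \<ge> 3" for k
  proof -
    have "8 * real k ^ 3 \<le> 3 * exp 1 * real k ^ 3"
      using exp_1_ge by (intro mult_right_mono) auto
    then show ?thesis using that by (simp add: C_def divide_le_eq_1)
  qed
  then have "limsup (\<lambda>k. ereal (C k / (3 * exp 1 * real k ^ 3))) \<le> 1"
    by (intro Limsup_bounded) (auto simp: eventually_sequentially one_ereal_def intro!: exI[of _ 3])
  moreover have "\<exists>\<sigma>. player1_strategy c \<sigma> \<and>
           ensures c \<sigma> (\<lambda>\<chi>.
             (\<forall>r\<ge>2. \<forall>a\<ge>1. \<forall>l\<ge>k * r.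
                (even r \<longrightarrow> contains_rainbow_ap \<chi> k r (block a l)) \<and>
                (odd r \<longrightarrow> contains_prismatic_pair \<chi> k r (block a l))) \<and>
             (\<forall>r\<ge>2. \<forall>a\<ge>1. \<forall>i<k. \<forall>j<k. i \<noteq> j \<longrightarrow>
                block_word \<chi> (a + i * r) r \<noteq> block_word \<chi> (a + j * r) r))"
    if k: "k \<ge> 2" and cC: "real c \<ge> C k" for k c
  proof -
    have "8 * real k ^ 2 * (real k - 1) \<le> C k"
      by (simp add: C_def power2_eq_square power3_eq_cube algebra_simps)
    then have c: "8 * real k ^ 2 * (real k - 1) \<le> real c" using cC by linarith
    have "0 < C k" using k by (simp add: C_def)
    then have "c > 0" using cC by (cases c) auto
    moreover have "\<exists>w. length w = n \<and> set w \<subseteq> {..<c} \<and> (\<forall>m\<le>n. good k (play \<tau> (take m w)))" for n \<tau>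
    proof -
      obtain w where w: "w \<in> good_words c k \<tau> n" using good_word_exists[OF k c] by blast
      then have "good k (play \<tau> (take m w))" if "m \<le> n" for m
        using good_words_take[OF w that] by (simp add: good_words_def)
      then show ?thesis using w by (auto simp: good_words_def)
    qed
    ultimately obtain \<sigma> where \<sigma>: "player1_strategy c \<sigma>"
      "ensures c \<sigma> (\<lambda>\<chi>. \<forall>n. good k (map \<chi> [1..<2 * n + 1]))"
      using safety_strategy[of c "good k"] by blast
    \<comment> \<open>A pattern is complete after \<open>b + k * r div 2\<close> rounds, so goodness
      of that one finite history excludes it.\<close>
    have "\<not> repeats \<chi> k b r" if "play_following c \<sigma> \<chi>" "r \<ge> 2" for \<chi> b r
    proof -
      let ?h = "map \<chi> [1..<2 * (b + k * r div 2) + 1]"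
      have "good k ?h" using \<sigma>(2) that(1) unfolding ensures_def by blast
      moreover have "2 \<le> r \<and> 2 * (b + k * r div 2) \<le> length ?h"
        using that(2) by (simp del: upt_Suc)
      ultimately have "\<not> repeats (\<lambda>p. ?h ! (p - 1)) k b r" unfolding good_def by blast
      moreover have "?h ! (p - 1) = \<chi> p" if "1 \<le> p" "p \<le> 2 * (b + k * r div 2)" for p
        using that by (simp add: nth_map_upt del: upt_Suc)
      then have "repeats (\<lambda>p. ?h ! (p - 1)) k b r \<longleftrightarrow> repeats \<chi> k b r" by (rule repeats_cong)
      ultimately show ?thesis by blast
    qed
    note nr = this
    have "ensures c \<sigma> (\<lambda>\<chi>.
             (\<forall>r\<ge>2. \<forall>a\<ge>1. \<forall>l\<ge>k * r.
                (even r \<longrightarrow> contains_rainbow_ap \<chi> k r (block a l)) \<and>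
                (odd r \<longrightarrow> contains_prismatic_pair \<chi> k r (block a l))) \<and>
             (\<forall>r\<ge>2. \<forall>a\<ge>1. \<forall>i<k. \<forall>j<k. i \<noteq> j \<longrightarrow>
                block_word \<chi> (a + i * r) r \<noteq> block_word \<chi> (a + j * r) r))"
      unfolding ensures_def
    proof (intro allI impI conjI)
      fix \<chi> r a l assume *: "play_following c \<sigma> \<chi>" "2 \<le> (r::nat)" "k * r \<le> l"
      show "contains_rainbow_ap \<chi> k r (block a l)" if "even r"
        using rainbow_ap_of_not_repeats[OF nr[OF *(1,2)] that *(3)] .
      show "contains_prismatic_pair \<chi> k r (block a l)" if "odd r"
        using prismatic_pair_of_not_repeats[OF nr[OF *(1,2)] that *(3)] .
    next
      fix \<chi> r a i j assume *: "play_following c \<sigma> \<chi>" "2 \<le> (r::nat)" "i < k" "j < k" "i \<noteq> j"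
      show "block_word \<chi> (a + i * r) r \<noteq> block_word \<chi> (a + j * r) r"
        using block_words_differ[OF nr[OF *(1,2)]] *(3-5) by (metis linorder_neqE_nat)
    qed
    then show ?thesis using \<sigma>(1) by blast
  qed
  moreover have "C 2 = 37" by (simp add: C_def)
  ultimately show ?thesis by blast
qed

end
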